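(* Let $n\ge1$, let $\boldsymbol x=\{x_1,\dots,x_{2n}\}$ be real and distinct, and let $\boldsymbol\zeta=\{\zeta_1,\dots,\zeta_{n+1}\}\subset\widehat{\mathbb C}$ be closed under complex conjugation with the $\zeta_i$ distinct. Then there exists $R\in\mathrm{CRR}_{n+1}(\boldsymbol x)$ with pole set $\boldsymbol\zeta$ if and only if $\boldsymbol\zeta\cap\boldsymbol x=\emptyset$ and $\boldsymbol\zeta$ satisfies the stationary relation $$\sum_{j=1}^{2n}\frac1{\zeta_k-x_j}=\sum_{l\ne k}\frac{2}{\zeta_k-\zeta_l},\qquad k=1,\dots,n+1.$$
   Context: $\widehat{\mathbb C}$ is the Riemann sphere. $\mathrm{CRR}_{n+1}(\boldsymbol x)$ is the set of rational functions with real coefficients, of degree $n+1$ (as maps $\widehat{\mathbb C}\to\widehat{\mathbb C}$), whose critical points are precisely $\boldsymbol x$. One of the $\zeta_k$ may be $\infty$ (with $\overline\infty=\infty$); in the stationary relation any fraction whose denominator involves $\infty$ is interpreted as $0$, so the equation with $\zeta_k=\infty$ is trivially satisfied. A pole at $\infty$ means $R(\infty)=\infty$. *)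

theory Defs
  imports "HOL-Complex_Analysis.Complex_Analysis" "HOL-Computational_Algebra.Computational_Algebra"
begin

text \<open>The Riemann sphere, with carrier as in \<^const>\<open>Alexandroff_compactification\<close>:
  \<^const>\<open>None\<close> is the point at infinity.\<close>

type_synonym sphere = "complex option"

abbreviation cnj_sphere :: "sphere \<Rightarrow> sphere" where
  "cnj_sphere \<equiv> map_option cnj"

text \<open>The self-map of the sphere induced by \<open>p / q\<close>. It is only used for coprime \<open>p\<close>, \<open>q\<close> with
  \<open>q \<noteq> 0\<close>, so that a zero of \<open>q\<close> is a pole. The value at infinity is the limit of \<open>p / q\<close> there.\<close>

definition rational_map :: "real poly \<Rightarrow> real poly \<Rightarrow> sphere \<Rightarrow> sphere" where
  "rational_map p q w = (case w of
     Some z \<Rightarrow>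
       let P = map_poly complex_of_real p; Q = map_poly complex_of_real q
       in if poly Q z = 0 then None else Some (poly P z / poly Q z)
   | None \<Rightarrow>
       if degree q < degree p then None
       else Some (complex_of_real (coeff p (degree q) / lead_coeff q)))"

definition real_rational_maps :: "nat \<Rightarrow> (sphere \<Rightarrow> sphere) set" where
  "real_rational_maps d =
     {rational_map p q | p q. q \<noteq> 0 \<and> coprime p q \<and> max (degree p) (degree q) = d}"

text \<open>Inverse of a holomorphic chart centred at the given point: \<open>0\<close> is sent to that point.\<close>

definition local_param :: "sphere \<Rightarrow> complex \<Rightarrow> sphere" where
  "local_param w h = (case w of
     Some z \<Rightarrow> Some (z + h)
   | None \<Rightarrow> if h = 0 then None else Some (1 / h))"

text \<open>A holomorphic coordinate near \<open>w\<close>: the identity if \<open>w\<close> is finite, and \<open>1 / v\<close> if \<open>w\<close> is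
  infinity. In the former case infinity is outside the chart and its value is a dummy.\<close>

definition local_coord :: "sphere \<Rightarrow> sphere \<Rightarrow> complex" where
  "local_coord w u = (case u of
     None \<Rightarrow> 0
   | Some v \<Rightarrow> if w = None then 1 / v else v)"

definition critical_points :: "(sphere \<Rightarrow> sphere) \<Rightarrow> sphere set" where
  "critical_points R =
     {w. ((\<lambda>h. local_coord (R w) (R (local_param w h))) has_field_derivative 0) (at 0)}"

definition poles :: "(sphere \<Rightarrow> sphere) \<Rightarrow> sphere set" where
  "poles R = {w. R w = None}"

definition CRR :: "nat \<Rightarrow> real set \<Rightarrow> (sphere \<Rightarrow> sphere) set" where
  "CRR d X = {R \<in> real_rational_maps d.
     critical_points R = (\<lambda>x. Some (complex_of_real x)) ` X}"

text \<open>The fraction \<open>1 / (u - v)\<close>, read as \<open>0\<close> if \<open>u\<close> or \<open>v\<close> is infinity.\<close>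

definition recip_diff :: "sphere \<Rightarrow> sphere \<Rightarrow> complex" where
  "recip_diff u v = (case (u, v) of
     (Some a, Some b) \<Rightarrow> 1 / (a - b)
   | _ \<Rightarrow> 0)"

definition stationary_relation :: "nat \<Rightarrow> (nat \<Rightarrow> real) \<Rightarrow> (nat \<Rightarrow> sphere) \<Rightarrow> bool" where
  "stationary_relation n x \<zeta> \<longleftrightarrow> (\<forall>k \<in> {1..n+1}.
     (\<Sum>j = 1..2*n. recip_diff (\<zeta> k) (Some (complex_of_real (x j)))) =
     (\<Sum>l \<in> {1..n+1} - {k}. 2 * recip_diff (\<zeta> k) (\<zeta> l)))"

end

theory Submission
  imports Defs "HOL-Computational_Algebra.Field_as_Ring"
begin

text \<open>For \<open>R = p / q\<close> of degree \<open>n + 1\<close>, the critical points are the zeros of the Wronskian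
  \<open>W = p' q - p q'\<close>, whose degree is at most \<open>2 n\<close>, with equality iff infinity is not critical.
  So the critical set is \<open>x\<close> iff \<open>W\<close> is a nonzero multiple of the product of the \<open>z - x\<^sub>j\<close>.
  At a zero of \<open>q\<close> we have \<open>W = - p q'\<close> and \<open>W' = - p q''\<close>, hence \<open>W' / W = q'' / q'\<close>, which is the
  stationary relation. Conversely, let \<open>q\<close> and \<open>W\<close> be the monic polynomials with roots \<open>\<zeta>\<close> and
  \<open>x\<close>. Choosing \<open>p\<close> with \<open>p q' \<equiv> - W\<close> modulo \<open>q\<close> makes \<open>p' q - p q' - W\<close> divisible by \<open>q\<close>, and
  the stationary relation, in the form \<open>q | W' q' - W q''\<close>, improves this to \<open>q\<^sup>2\<close>. Comparing degrees,
  the difference vanishes, after adding \<open>z q\<close> to \<open>p\<close> if infinity is one of the poles.\<close>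

section \<open>Polynomials\<close>

abbreviation cpoly :: "real poly \<Rightarrow> complex poly" where
  "cpoly \<equiv> map_poly complex_of_real"

lemma cpoly_add: "cpoly (p + q) = cpoly p + cpoly q"
  by (rule poly_eqI) (simp add: coeff_map_poly)

lemma cpoly_diff: "cpoly (p - q) = cpoly p - cpoly q"
  by (rule poly_eqI) (simp add: coeff_map_poly)

lemma cpoly_mult: "cpoly (p * q) = cpoly p * cpoly q"
  by (rule poly_eqI) (simp add: coeff_map_poly coeff_mult)

lemma cpoly_smult: "cpoly (smult c p) = smult (of_real c) (cpoly p)"
  by (rule poly_eqI) (simp add: coeff_map_poly)

lemma cpoly_pderiv: "cpoly (pderiv p) = pderiv (cpoly p)"
  by (rule poly_eqI) (simp add: coeff_map_poly coeff_pderiv)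

lemma cpoly_prod: "cpoly (\<Prod>x\<in>A. f x) = (\<Prod>x\<in>A. cpoly (f x))"
  by (induction A rule: infinite_finite_induct) (simp_all add: cpoly_mult)

lemma cpoly_eq_0_iff: "cpoly p = 0 \<longleftrightarrow> p = 0"
  by (simp add: poly_eq_iff coeff_map_poly)

lemma degree_cpoly: "degree (cpoly p) = degree p"
  by (cases "p = 0") (simp_all add: map_poly_degree_eq)

lemma poly_cpoly_of_real: "poly (cpoly p) (of_real x) = of_real (poly p x)"
  by (induction p) (simp_all add: map_poly_pCons)

lemmas cpoly_simps = cpoly_add cpoly_diff cpoly_mult cpoly_smult cpoly_pderiv

lemma bezout_real_poly:
  fixes p q :: "real poly"
  assumes "coprime p q"
  obtains u v where "u * p + v * q = 1"
  using assms bezout_coefficients_fst_snd[of p q] by (metis coprime_imp_gcd_eq_1)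

text \<open>Bezout over the reals excludes a common complex zero. Conversely, a common real factor
  without complex zeros is constant by the fundamental theorem of algebra.\<close>

lemma coprime_iff_no_common_root:
  "coprime p q \<longleftrightarrow> (\<forall>z. poly (cpoly p) z \<noteq> 0 \<or> poly (cpoly q) z \<noteq> 0)"
proof
  assume "coprime p q"
  then obtain u v where "u * p + v * q = 1" by (rule bezout_real_poly)
  then have "cpoly u * cpoly p + cpoly v * cpoly q = 1"
    by (metis cpoly_add cpoly_mult map_poly_1' of_real_1)
  then have "poly (cpoly u) z * poly (cpoly p) z + poly (cpoly v) z * poly (cpoly q) z = 1" for z
    by (metis poly_1 poly_add poly_mult)
  then show "\<forall>z. poly (cpoly p) z \<noteq> 0 \<or> poly (cpoly q) z \<noteq> 0"
    by (metis add_0 mult_zero_right zero_neq_one)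
next
  assume R: "\<forall>z. poly (cpoly p) z \<noteq> 0 \<or> poly (cpoly q) z \<noteq> 0"
  show "coprime p q"
  proof (rule coprimeI)
    fix c assume "c dvd p" "c dvd q"
    then obtain a b where ab: "p = c * a" "q = c * b" by (auto simp: dvd_def)
    with R have nz: "poly (cpoly c) z \<noteq> 0" for z by (auto simp: cpoly_mult)
    then have "constant (poly (cpoly c))"
      using fundamental_theorem_of_algebra[of "cpoly c"] by blast
    then have "degree c = 0" by (simp add: constant_degree degree_cpoly)
    moreover have "c \<noteq> 0" using nz by auto
    ultimately show "is_unit c" by (simp add: is_unit_iff_degree)
  qed
qed

section \<open>Monic polynomials with prescribed simple roots\<close>

abbreviation root_poly :: "'a::comm_ring_1 set \<Rightarrow> 'a poly" where
  "root_poly S \<equiv> \<Prod>a\<in>S. [:- a, 1:]"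

lemma degree_root_poly: "degree (root_poly (S :: 'a::idom set)) = card S"
  by (subst degree_prod_eq_sum_degree) auto

lemma coeff_root_poly_card: "coeff (root_poly (S :: 'a::idom set)) (card S) = 1"
  using lead_coeff_prod[of "\<lambda>a. [:- a, 1:]" S] by (simp add: degree_root_poly)

lemma poly_root_poly_eq_0_iff:
  "finite S \<Longrightarrow> poly (root_poly (S :: 'a::idom set)) z = 0 \<longleftrightarrow> z \<in> S"
  by (auto simp: poly_prod)

text \<open>Both sides agree at \<open>card S\<close> points and in the coefficient of that degree.
  This coefficient may be zero a priori; its nonvanishing is obtained separately where it
  matters.\<close>

lemma poly_eq_smult_root_poly:
  fixes f :: "'a::idom poly"
  assumes "finite S" "\<And>a. a \<in> S \<Longrightarrow> poly f a = 0" "degree f \<le> card S"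
  shows "f = smult (coeff f (card S)) (root_poly S)"
proof (rule poly_eqI_degree_lead_coeff[of _ "card S" _ S])
  show "poly f a = poly (smult (coeff f (card S)) (root_poly S)) a" if "a \<in> S" for a
    using assms that poly_root_poly_eq_0_iff[of S a] by simp
qed (use assms in \<open>auto simp: coeff_root_poly_card degree_root_poly
       intro: order.trans[OF degree_smult_le]\<close>)

text \<open>The logarithmic derivative of a product of linear factors.\<close>

lemma poly_pderiv_root_poly:
  fixes S :: "'a::field set"
  assumes "finite S" "z \<notin> S"
  shows "poly (pderiv (root_poly S)) z = poly (root_poly S) z * (\<Sum>a\<in>S. 1 / (z - a))"
  using assms
proof (induction S rule: finite_induct)
  case (insert b S)
  then show ?case
    by (simp add: pderiv_mult pderiv_pCons del: mult_pCons_left) (simp add: field_simps)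
qed simp

lemma root_poly_remove:
  assumes "finite S" "z \<in> S"
  shows "root_poly S = [:- z, 1:] * root_poly (S - {z})"
  using assms by (simp add: prod.remove)

text \<open>Differentiate \<open>(X - z) * g\<close> once and twice, and put \<open>X = z\<close>.
  The second derivative gives the factor 2 of the stationary relation.\<close>

lemma pderiv_root_poly_at_root:
  fixes S :: "'a::field set"
  assumes "finite S" "z \<in> S"
  shows "poly (pderiv (root_poly S)) z = poly (root_poly (S - {z})) z"
    and "poly (pderiv (pderiv (root_poly S))) z = 2 * poly (pderiv (root_poly (S - {z}))) z"
  by (simp_all add: root_poly_remove[OF assms] pderiv_mult pderiv_pCons pderiv_add pderiv_diff
      del: mult_pCons_left)

text \<open>This is W'/W = Q''/Q' at \<open>z\<close>, cleared of denominators. Both denominators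
  are nonzero: \<open>z\<close> is not in \<open>S\<close>, and \<open>z\<close> is a simple root of
  \<open>Q\<close>.\<close>

lemma stationary_iff_derivatives:
  fixes z :: "'a::field"
  assumes "finite S" "finite T" "z \<in> T" "z \<notin> S"
    and W: "W = smult b (root_poly S)" "b \<noteq> 0" and Q: "Q = smult c (root_poly T)" "c \<noteq> 0"
  shows "poly (pderiv W) z * poly (pderiv Q) z = poly W z * poly (pderiv (pderiv Q)) z \<longleftrightarrow>
    (\<Sum>a\<in>S. 1 / (z - a)) = (\<Sum>a\<in>T - {z}. 2 / (z - a))"
proof -
  define f g where "f = poly (root_poly S) z" and "g = poly (root_poly (T - {z})) z"
  have nz: "f \<noteq> 0" "g \<noteq> 0"
    using assms poly_root_poly_eq_0_iff[of S z] poly_root_poly_eq_0_iff[of "T - {z}" z]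
    by (auto simp: f_def g_def)
  have "poly (pderiv W) z = b * f * (\<Sum>a\<in>S. 1 / (z - a))"
    using assms by (simp add: f_def pderiv_smult poly_pderiv_root_poly)
  moreover have "poly W z = b * f" by (simp add: W f_def)
  moreover have "poly (pderiv Q) z = c * g"
    using assms by (simp add: g_def pderiv_smult pderiv_root_poly_at_root)
  moreover have "poly (pderiv (pderiv Q)) z = c * g * (\<Sum>a\<in>T - {z}. 2 / (z - a))"
    using assms poly_pderiv_root_poly[of "T - {z}" z]
    by (simp add: g_def pderiv_smult pderiv_root_poly_at_root sum_distrib_left algebra_simps)
  ultimately show ?thesis using nz W(2) Q(2) by auto
qed

section \<open>Descent from complex to real polynomials\<close>

lemma cpoly_root_poly: "cpoly (root_poly X) = root_poly (complex_of_real ` X)"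
  by (simp add: cpoly_prod map_poly_pCons prod.reindex inj_on_def)

text \<open>Conjugation permutes the linear factors, hence fixes every coefficient.\<close>

lemma real_poly_with_roots:
  assumes "finite Z" "\<And>z. z \<in> Z \<Longrightarrow> cnj z \<in> Z"
  obtains q where "cpoly q = root_poly Z"
proof
  have cnjZ: "bij_betw cnj Z Z"
    using assms(2) by (intro bij_betw_byWitness[where f' = cnj]) auto
  have "poly (map_poly cnj (root_poly Z)) x = poly (root_poly Z) x" for x
    using prod.reindex_bij_betw[OF cnjZ, of "\<lambda>a. x - a"] by (simp add: poly_prod)
  then have "map_poly cnj (root_poly Z) = root_poly Z" by (simp add: poly_eq_poly_eq_iff[symmetric] fun_eq_iff)
  then have "cnj (coeff (root_poly Z) i) = coeff (root_poly Z) i" for i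
    by (metis coeff_map_poly complex_cnj_zero)
  then have "complex_of_real (Re (coeff (root_poly Z) i)) = coeff (root_poly Z) i" for i
    by (simp add: complex_eq_iff)
  then show "cpoly (map_poly Re (root_poly Z)) = root_poly Z"
    by (intro poly_eqI) (simp add: coeff_map_poly)
qed

text \<open>The remainder modulo \<open>q\<close> has degree below \<open>card Z\<close> but
  vanishes on \<open>Z\<close>, so it is zero.\<close>

lemma dvd_if_vanishes_on_roots:
  assumes "finite Z" and q: "cpoly q = root_poly Z" and f: "\<And>z. z \<in> Z \<Longrightarrow> poly (cpoly f) z = 0"
  shows "q dvd f"
proof (rule ccontr)
  assume ndvd: "\<not> q dvd f"
  have "root_poly Z \<noteq> 0" using assms(1) by simp
  then have "q \<noteq> 0" using q by auto
  then have "degree (f mod q) < degree q"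
    using degree_mod_less_degree ndvd by blast
  moreover have "degree q = card Z" using q degree_cpoly degree_root_poly by metis
  ultimately have deg: "degree (cpoly (f mod q)) < card Z" by (simp add: degree_cpoly)
  have "cpoly f = cpoly (f div q) * cpoly q + cpoly (f mod q)"
    by (metis cpoly_add cpoly_mult div_mult_mod_eq)
  then have "poly (cpoly (f mod q)) z = 0" if "z \<in> Z" for z
    using f[OF that] poly_root_poly_eq_0_iff[OF assms(1), of z] that by (simp add: q)
  then have "cpoly (f mod q) = 0"
    using deg by (intro poly_eqI_degree[of Z]) auto
  then show False using ndvd by (simp add: cpoly_eq_0_iff dvd_eq_mod_eq_0)
qed

section \<open>The Wronskian\<close>

definition wronskian :: "'a::idom poly \<Rightarrow> 'a poly \<Rightarrow> 'a poly" where
  "wronskian p q = pderiv p * q - p * pderiv q"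

lemma cpoly_wronskian: "cpoly (wronskian p q) = wronskian (cpoly p) (cpoly q)"
  by (simp add: wronskian_def cpoly_simps)

lemma wronskian_swap: "wronskian q p = - wronskian p q"
  by (simp add: wronskian_def mult.commute)

section \<open>Degree and top coefficient of the Wronskian\<close>

lemma coeff_mult_top:
  fixes p q :: "'a::comm_semiring_0 poly"
  assumes "degree p \<le> a" "degree q \<le> b"
  shows "coeff (p * q) (a + b) = coeff p a * coeff q b"
proof -
  have "coeff (p * q) (a + b) = (\<Sum>i\<le>a + b. coeff p i * coeff q (a + b - i))"
    by (rule coeff_mult)
  also have "\<dots> = (\<Sum>i\<in>{a}. coeff p i * coeff q (a + b - i))"
  proof (intro sum.mono_neutral_right ballI)
    fix i assume "i \<in> {..a + b} - {a}"
    then have "i > a \<or> a + b - i > b" by auto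
    then show "coeff p i * coeff q (a + b - i) = 0"
      using assms coeff_eq_0[of p i] coeff_eq_0[of q "a + b - i"] by auto
  qed auto
  finally show ?thesis by simp
qed

lemma coeff_mult_subtop:
  fixes p q :: "'a::comm_semiring_0 poly"
  assumes "degree p \<le> Suc a" "degree q \<le> Suc b"
  shows "coeff (p * q) (Suc (a + b)) = coeff p (Suc a) * coeff q b + coeff p a * coeff q (Suc b)"
proof -
  have "coeff (p * q) (Suc (a + b)) = (\<Sum>i\<le>Suc (a + b). coeff p i * coeff q (Suc (a + b) - i))"
    by (rule coeff_mult)
  also have "\<dots> = (\<Sum>i\<in>{a, Suc a}. coeff p i * coeff q (Suc (a + b) - i))"
  proof (intro sum.mono_neutral_right ballI)
    fix i assume "i \<in> {..Suc (a + b)} - {a, Suc a}"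
    then have "i > Suc a \<or> Suc (a + b) - i > Suc b" by auto
    then show "coeff p i * coeff q (Suc (a + b) - i) = 0"
      using assms coeff_eq_0[of p i] coeff_eq_0[of q "Suc (a + b) - i"] by auto
  qed auto
  finally show ?thesis by (simp add: Suc_diff_le add.commute)
qed

text \<open>The evident bound is \<open>2 * n + 1\<close>; in that degree both products have the
  coefficient \<open>n + 1\<close> times the product of the top coefficients, and these
  cancel.\<close>

lemma degree_wronskian_le:
  fixes p q :: "'a::{idom,semiring_char_0} poly"
  assumes "degree p \<le> Suc n" "degree q \<le> Suc n"
  shows "degree (wronskian p q) \<le> 2 * n"
proof -
  have d: "degree (pderiv p) \<le> n" "degree (pderiv q) \<le> n"
    using assms by (simp_all add: degree_pderiv)
  have "degree (pderiv p * q) \<le> Suc (2 * n)" "degree (p * pderiv q) \<le> Suc (2 * n)"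
    using degree_mult_le[of "pderiv p" q] degree_mult_le[of p "pderiv q"] assms d by linarith+
  then have "degree (wronskian p q) \<le> Suc (2 * n)"
    unfolding wronskian_def by (rule degree_diff_le)
  moreover have "coeff (wronskian p q) (Suc (2 * n)) = 0"
    using coeff_mult_top[OF d(1) assms(2)] coeff_mult_top[OF assms(1) d(2)]
    by (simp add: wronskian_def coeff_pderiv mult_2)
  ultimately show ?thesis
    by (metis degree_0 le_SucE leading_coeff_0_iff zero_le)
qed

text \<open>Each of the two monomials occurs with weights \<open>n + 1\<close> and \<open>n\<close>
  in the two products, so a difference of one survives. This coefficient decides whether infinity is
  critical.\<close>

lemma coeff_wronskian_top:
  fixes p q :: "'a::{idom,semiring_char_0} poly"
  assumes "n \<ge> 1" "degree p \<le> Suc n" "degree q \<le> Suc n"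
  shows "coeff (wronskian p q) (2 * n) =
    coeff p (Suc n) * coeff q n - coeff p n * coeff q (Suc n)"
proof -
  obtain m where m: "n = Suc m" using assms(1) by (cases n) auto
  have d: "degree (pderiv p) \<le> Suc m" "degree (pderiv q) \<le> Suc m"
    using assms m by (simp_all add: degree_pderiv)
  have e: "2 * n = Suc (m + n)" "2 * n = Suc (n + m)" by (simp_all add: m)
  have "coeff (pderiv p * q) (2 * n) =
      of_nat (Suc n) * coeff p (Suc n) * coeff q n + of_nat n * coeff p n * coeff q (Suc n)"
    unfolding e(1) by (subst coeff_mult_subtop[OF d(1) assms(3)]) (simp add: coeff_pderiv m)
  moreover have "coeff (p * pderiv q) (2 * n) =
      coeff p (Suc n) * (of_nat n * coeff q n) + coeff p n * (of_nat (Suc n) * coeff q (Suc n))"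
    unfolding e(2) by (subst coeff_mult_subtop[OF assms(2) d(2)]) (simp add: coeff_pderiv m)
  ultimately show ?thesis by (simp add: wronskian_def algebra_simps)
qed

text \<open>The existence half: a numerator \<open>p\<close> is built from the denominator
  \<open>q\<close> and the prescribed Wronskian. Degree \<open>n\<close> of \<open>q\<close> is the
  case of a pole at infinity, which the last conclusion records.\<close>

lemma wronskian_solution:
  fixes q W :: "real poly"
  assumes n: "n \<ge> 1" and degq: "degree q = n \<or> degree q = Suc n" and monic: "lead_coeff q = 1"
    and cop: "coprime q (pderiv q)"
    and W: "degree W = 2 * n" "lead_coeff W = 1"
    and dvd: "q dvd pderiv W * pderiv q - W * pderiv (pderiv q)"
  obtains p where "wronskian p q = W" "max (degree p) (degree q) = Suc n"
    "degree q < degree p \<longleftrightarrow> degree q = n"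
proof -
  obtain u v where uv: "u * q + v * pderiv q = 1"
    using cop by (rule bezout_real_poly)
  \<comment> \<open>By Bezout, \<open>v\<close> inverts \<open>pderiv q\<close> modulo
    \<open>q\<close>, so \<open>p * pderiv q\<close> is congruent to \<open>- W\<close>. Reduction
    modulo \<open>q\<close> keeps the degree small.\<close>
  define p where "p = (- W * v) mod q"
  have "q \<noteq> 0" using monic by auto
  have degp: "degree p < degree q"
    unfolding p_def using degree_mod_less[OF \<open>q \<noteq> 0\<close>, of "- W * v"] degq n by auto
  have "q dvd - W * v - p" unfolding p_def by (rule dvd_minus_mod)
  then obtain t where "- W * v - p = q * t" by (auto simp: dvd_def)
  then have p: "p = - W * v - q * t" by (simp add: algebra_simps)
  define k where "k = W * u - t * pderiv q"
  have "p * pderiv q + W = W * (1 - v * pderiv q) - q * t * pderiv q"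
    by (simp add: p algebra_simps)
  also have "\<dots> = q * k" by (simp add: uv[symmetric] k_def algebra_simps)
  finally have k: "p * pderiv q = q * k - W" by (simp add: algebra_simps)
  define g where "g = wronskian p q - W"
  have g: "g = q * (pderiv p - k)" by (simp add: g_def wronskian_def k algebra_simps)
  have g': "pderiv g = q * pderiv (pderiv p) - p * pderiv (pderiv q) - pderiv W"
    by (simp add: g_def wronskian_def pderiv_add pderiv_diff pderiv_mult algebra_simps)
  \<comment> \<open>The factor \<open>pderiv q\<close> allows \<open>p * pderiv q\<close> to be
    replaced by \<open>q * k - W\<close>; what remains modulo \<open>q\<close> is the expression in
    the hypothesis \<open>dvd\<close>.\<close>
  have "pderiv q * pderiv g = q * (pderiv q * pderiv (pderiv p)) -
      (p * pderiv q) * pderiv (pderiv q) - pderiv W * pderiv q"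
    by (simp add: g' algebra_simps)
  also have "\<dots> = q * (pderiv q * pderiv (pderiv p) - k * pderiv (pderiv q)) -
      (pderiv W * pderiv q - W * pderiv (pderiv q))"
    by (simp add: k algebra_simps)
  finally have "q dvd pderiv q * pderiv g" using dvd by simp
  then have "q dvd pderiv g" using cop by (simp add: coprime_dvd_mult_right_iff)
  \<comment> \<open>As \<open>q\<close> divides \<open>g\<close> and \<open>pderiv g\<close> and is
    coprime to \<open>pderiv q\<close>, the product rule shows that \<open>q\<close> also divides
    the cofactor of \<open>q\<close> in \<open>g\<close>.\<close>
  moreover have "pderiv g = pderiv q * (pderiv p - k) + q * pderiv (pderiv p - k)"
    unfolding g pderiv_mult by (simp add: mult.commute)
  ultimately have "q dvd pderiv q * (pderiv p - k)"
    by (simp add: dvd_add_left_iff)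
  then have "q dvd pderiv p - k" using cop by (simp add: coprime_dvd_mult_right_iff)
  then have q2: "q * q dvd g" by (simp add: g)
  have degqq: "degree (q * q) = 2 * degree q" using \<open>q \<noteq> 0\<close> by (simp add: degree_mult_eq)
  from degq show ?thesis
  proof
    assume "degree q = Suc n"
    \<comment> \<open>\<open>q * q\<close> has degree \<open>2 * n + 2\<close> here, too large to
      divide a nonzero \<open>g\<close>.\<close>
    have "degree g \<le> 2 * n" unfolding g_def
      using degp \<open>degree q = Suc n\<close> W by (intro degree_diff_le degree_wronskian_le) auto
    then have "g = 0" using q2 degqq dvd_imp_degree_le[OF q2] \<open>degree q = Suc n\<close> by force
    then have "wronskian p q = W" by (simp add: g_def)
    then show ?thesis using degp \<open>degree q = Suc n\<close> by (intro that) auto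
  next
    assume dq: "degree q = n"
    obtain m where m: "n = Suc m" using n by (cases n) auto
    \<comment> \<open>Adding \<open>X * q\<close> to \<open>p\<close> adds exactly
      \<open>q * q\<close> to the Wronskian. Divisibility by \<open>q * q\<close> is kept, and the
      monic \<open>q * q\<close> of degree \<open>2 * n\<close> cancels the leading term of
      \<open>W\<close>.\<close>
    define r where "r = p + [:0, 1:] * q"
    have wr: "wronskian r q = wronskian p q + q * q"
      by (simp add: wronskian_def r_def pderiv_add pderiv_mult pderiv_pCons algebra_simps)
    then have "wronskian r q - W = g + q * q" by (simp add: g_def)
    then have "q * q dvd wronskian r q - W" using q2 by simp
    moreover have "degree (wronskian r q - W) < 2 * n"
    proof -
      have "degree (q * q - W) \<le> 2 * n"
        using degqq dq W by (intro degree_diff_le) auto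
      moreover have "coeff (q * q - W) (2 * n) = 0"
        using coeff_mult_top[of q n q n] dq monic W by (simp add: mult_2)
      ultimately have "degree (q * q - W) < 2 * n"
        using n leading_coeff_0_iff[of "q * q - W"]
        by (cases "degree (q * q - W) = 2 * n") (auto simp del: leading_coeff_0_iff coeff_diff)
      moreover have "degree (wronskian p q) \<le> 2 * m"
        using degp dq m by (intro degree_wronskian_le) auto
      ultimately have "degree (wronskian p q + (q * q - W)) < 2 * n"
        using m by (intro degree_add_less) auto
      then show ?thesis by (simp add: wr algebra_simps)
    qed
    ultimately have "wronskian r q - W = 0"
      using degqq dq by (metis dvd_imp_degree_le not_less)
    then have "wronskian r q = W" by simp
    moreover have "degree r = Suc n"
      unfolding r_def using degp dq \<open>q \<noteq> 0\<close>
      by (subst degree_add_eq_right) (auto simp: degree_mult_eq)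
    ultimately show ?thesis using dq by (intro that) auto
  qed
qed

section \<open>Critical points of rational maps\<close>

text \<open>The Wronskian is the numerator in the quotient rule.\<close>

lemma quotient_derivative_eq_0_iff:
  fixes F G :: "complex poly"
  assumes "poly G z \<noteq> 0"
  shows "((\<lambda>h. poly F (z + h) / poly G (z + h)) has_field_derivative 0) (at 0) \<longleftrightarrow>
    poly (wronskian F G) z = 0"
proof -
  have *: "((\<lambda>h. poly H (z + h)) has_field_derivative poly (pderiv H) z) (at 0)" for H
    using DERIV_shift[of "poly H" "poly (pderiv H) z" 0 z] by (simp add: add.commute)
  have "((\<lambda>h. poly F (z + h) / poly G (z + h)) has_field_derivative
      poly (wronskian F G) z / (poly G z * poly G z)) (at 0)"
    using DERIV_divide[OF *[of F] *[of G]] assms by (simp add: wronskian_def)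
  then show ?thesis using assms DERIV_unique by fastforce
qed

lemma Some_critical_iff:
  assumes "coprime p q"
  shows "Some z \<in> critical_points (rational_map p q) \<longleftrightarrow> poly (cpoly (wronskian p q)) z = 0"
proof (cases "poly (cpoly q) z = 0")
  case False
  \<comment> \<open>The functions agree for every \<open>h\<close>, not only near 0: at a pole the
    dummy value 0 matches division by zero.\<close>
  then have "(\<lambda>h. local_coord (rational_map p q (Some z)) (rational_map p q (local_param (Some z) h)))
      = (\<lambda>h. poly (cpoly p) (z + h) / poly (cpoly q) (z + h))"
    by (auto simp: local_coord_def rational_map_def local_param_def Let_def)
  then show ?thesis
    using False by (simp add: critical_points_def quotient_derivative_eq_0_iff cpoly_wronskian)
next
  case True
  then have "poly (cpoly p) z \<noteq> 0" using assms coprime_iff_no_common_root by blast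
  \<comment> \<open>At a pole the coordinate of the value is its reciprocal, so the roles of
    \<open>p\<close> and \<open>q\<close> are exchanged, which only changes the sign of the
    Wronskian.\<close>
  moreover have "(\<lambda>h. local_coord (rational_map p q (Some z))
        (rational_map p q (local_param (Some z) h)))
      = (\<lambda>h. poly (cpoly q) (z + h) / poly (cpoly p) (z + h))"
    using True by (auto simp: local_coord_def rational_map_def local_param_def Let_def)
  ultimately show ?thesis
    by (simp add: critical_points_def quotient_derivative_eq_0_iff cpoly_wronskian
        wronskian_swap[of "cpoly q"])
qed

text \<open>The polynomial \<open>X^d * p(1/X)\<close>. Reversal is relative to a formal degree
  \<open>d\<close>, so that numerator and denominator can be multiplied by the same power of
  \<open>X\<close>.\<close>

definition reversed_poly :: "nat \<Rightarrow> 'a::field poly \<Rightarrow> 'a poly" where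
  "reversed_poly d p = monom 1 (d - degree p) * reflect_poly p"

lemma coeff_reversed_poly:
  assumes "degree p \<le> d" "i \<le> d"
  shows "coeff (reversed_poly d p) i = coeff p (d - i)"
  using assms by (auto simp: reversed_poly_def coeff_monom_mult coeff_reflect_poly coeff_eq_0)

lemma poly_reversed_poly:
  assumes "degree p \<le> d" "h \<noteq> 0"
  shows "poly (reversed_poly d p) h = h ^ d * poly p (1 / h)"
  using assms power_add[of h "d - degree p" "degree p"]
  by (simp add: reversed_poly_def poly_monom poly_reflect_poly_nz inverse_eq_divide)

lemma poly_wronskian_reversed_0:
  assumes "degree p \<le> Suc n" "degree q \<le> Suc n"
  shows "poly (wronskian (reversed_poly (Suc n) p) (reversed_poly (Suc n) q)) 0 =
    coeff p n * coeff q (Suc n) - coeff p (Suc n) * coeff q n"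
  using assms by (simp add: wronskian_def poly_0_coeff_0 coeff_mult coeff_pderiv coeff_reversed_poly)

text \<open>In the chart \<open>h = 1 / z\<close> the map is a quotient of reversed polynomials,
  whose Wronskian at 0 is minus the coefficient of degree \<open>2 * n\<close> of the original
  one.\<close>

lemma None_critical_iff:
  assumes "n \<ge> 1" "q \<noteq> 0" "max (degree p) (degree q) = Suc n"
  shows "None \<in> critical_points (rational_map p q) \<longleftrightarrow> coeff (wronskian p q) (2 * n) = 0"
proof -
  let ?R = "rational_map p q"
  define P Q where "P = reversed_poly (Suc n) (cpoly p)" and "Q = reversed_poly (Suc n) (cpoly q)"
  have deg: "degree p \<le> Suc n" "degree q \<le> Suc n" using assms(3) by auto
  have P: "poly P h = h ^ Suc n * poly (cpoly p) (1 / h)" and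
    Q: "poly Q h = h ^ Suc n * poly (cpoly q) (1 / h)" if "h \<noteq> 0" for h
    using that deg by (simp_all add: P_def Q_def poly_reversed_poly degree_cpoly)
  have P0: "poly P 0 = of_real (coeff p (Suc n))" and Q0: "poly Q 0 = of_real (coeff q (Suc n))"
    using deg by (simp_all add: P_def Q_def poly_0_coeff_0 coeff_reversed_poly degree_cpoly
        coeff_map_poly)
  have "poly (wronskian P Q) 0 = of_real (coeff p n * coeff q (Suc n) - coeff p (Suc n) * coeff q n)"
    using deg by (simp add: P_def Q_def poly_wronskian_reversed_0 degree_cpoly coeff_map_poly)
  then have W: "poly (wronskian P Q) 0 = - of_real (coeff (wronskian p q) (2 * n))"
    using coeff_wronskian_top[OF assms(1) deg] by simp
  show ?thesis
  proof (cases "degree q < degree p")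
    \<comment> \<open>Infinity is a pole, so the reciprocal \<open>Q / P\<close> is
      differentiated.\<close>
    case True
    then have "degree p = Suc n" using assms(3) by auto
    then have "poly P 0 \<noteq> 0" by (metis P0 degree_0 leading_coeff_0_iff nat.distinct(1) of_real_eq_0_iff)
    moreover have "poly Q 0 = 0" using True \<open>degree p = Suc n\<close> by (simp add: Q0 coeff_eq_0)
    ultimately have "(\<lambda>h. local_coord (?R None) (?R (local_param None h))) =
        (\<lambda>h. poly Q (0 + h) / poly P (0 + h))"
      using True by (auto simp: fun_eq_iff local_coord_def rational_map_def local_param_def Let_def P Q)
    then show ?thesis
      using quotient_derivative_eq_0_iff[OF \<open>poly P 0 \<noteq> 0\<close>, of Q] W
      by (simp add: critical_points_def wronskian_swap[of Q])
  next
    case False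
    then have dq: "degree q = Suc n" using assms(3) by auto
    then have "poly Q 0 \<noteq> 0" by (metis Q0 degree_0 leading_coeff_0_iff nat.distinct(1) of_real_eq_0_iff)
    moreover have "(\<lambda>h. local_coord (?R None) (?R (local_param None h))) =
        (\<lambda>h. poly P (0 + h) / poly Q (0 + h))"
      using False dq
      by (auto simp: fun_eq_iff local_coord_def rational_map_def local_param_def Let_def P Q P0 Q0)
    ultimately show ?thesis
      using quotient_derivative_eq_0_iff[of Q 0 P] W
      by (simp add: critical_points_def)
  qed
qed

text \<open>Infinity being noncritical means that the Wronskian has full degree
  \<open>2 * n\<close>; its \<open>2 * n\<close> distinct zeros then determine it up to a
  scalar.\<close>

lemma critical_points_eq_iff:
  assumes "n \<ge> 1" "coprime p q" "q \<noteq> 0" "max (degree p) (degree q) = Suc n"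
    and X: "finite X" "card X = 2 * n"
  shows "critical_points (rational_map p q) = (\<lambda>x. Some (complex_of_real x)) ` X \<longleftrightarrow>
    (\<exists>b. b \<noteq> 0 \<and> wronskian p q = smult b (root_poly X))" (is "?C = _ \<longleftrightarrow> _")
proof
  assume C: "?C = (\<lambda>x. Some (complex_of_real x)) ` X"
  then have "None \<notin> ?C" by auto
  then have nz: "coeff (wronskian p q) (2 * n) \<noteq> 0" using None_critical_iff assms by blast
  have "poly (wronskian p q) x = 0" if "x \<in> X" for x
  proof -
    have "Some (complex_of_real x) \<in> ?C" using C that by auto
    then show ?thesis using Some_critical_iff[OF assms(2)] by (simp add: poly_cpoly_of_real)
  qed
  moreover have "degree (wronskian p q) \<le> card X"
    using assms(4) X(2) degree_wronskian_le[of p n q] by simp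
  ultimately have "wronskian p q = smult (coeff (wronskian p q) (card X)) (root_poly X)"
    using X(1) by (intro poly_eq_smult_root_poly)
  then show "\<exists>b. b \<noteq> 0 \<and> wronskian p q = smult b (root_poly X)" using nz X(2) by metis
next
  assume "\<exists>b. b \<noteq> 0 \<and> wronskian p q = smult b (root_poly X)"
  then obtain b where b: "b \<noteq> 0" "wronskian p q = smult b (root_poly X)" by blast
  have "coeff (wronskian p q) (2 * n) = b"
    using coeff_root_poly_card[of X] X(2) by (simp add: b)
  then have "None \<notin> ?C" using None_critical_iff assms b(1) by blast
  moreover have "Some z \<in> ?C \<longleftrightarrow> z \<in> complex_of_real ` X" for z
    using Some_critical_iff[OF assms(2), of z] b poly_root_poly_eq_0_iff[of "complex_of_real ` X" z]
      X(1) by (simp add: cpoly_smult cpoly_root_poly)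
  ultimately have "w \<in> ?C \<longleftrightarrow> w \<in> (\<lambda>x. Some (complex_of_real x)) ` X" for w
    by (cases w) auto
  then show "?C = (\<lambda>x. Some (complex_of_real x)) ` X" by blast
qed

lemma Some_pole_iff: "Some z \<in> poles (rational_map p q) \<longleftrightarrow> poly (cpoly q) z = 0"
  by (simp add: poles_def rational_map_def Let_def)

lemma None_pole_iff: "None \<in> poles (rational_map p q) \<longleftrightarrow> degree q < degree p"
  by (simp add: poles_def rational_map_def)

section \<open>The stationary relation\<close>

text \<open>Injectivity turns indexed sums into sums over sets. A point at infinity contributes zero
  terms, and its own equation reads 0 = 0, so only finite points remain.\<close>

lemma stationary_relation_iff:
  assumes "inj_on x {1..2*n}" "inj_on \<zeta> {1..n+1}"
    and S: "S = complex_of_real ` x ` {1..2*n}" and Z: "Z = {z. Some z \<in> \<zeta> ` {1..n+1}}"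
  shows "stationary_relation n x \<zeta> \<longleftrightarrow>
    (\<forall>z\<in>Z. (\<Sum>a\<in>S. 1 / (z - a)) = (\<Sum>a\<in>Z - {z}. 2 / (z - a)))"
proof -
  let ?I = "{1..n+1}"
  have mem_Z: "z \<in> Z \<longleftrightarrow> (\<exists>k\<in>?I. \<zeta> k = Some z)" for z
    unfolding Z mem_Collect_eq image_iff by metis
  have left: "(\<Sum>j = 1..2*n. recip_diff (Some z) (Some (complex_of_real (x j)))) =
      (\<Sum>a\<in>S. 1 / (z - a))" for z
  proof -
    have "inj_on (\<lambda>j. complex_of_real (x j)) {1..2*n}"
      using assms(1) unfolding inj_on_def of_real_eq_iff .
    from sum.reindex[OF this, of "\<lambda>a. 1 / (z - a)"] show ?thesis
      unfolding S image_image by (simp only: o_def recip_diff_def prod.case option.case)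
  qed
  have right: "(\<Sum>l\<in>?I - {k}. 2 * recip_diff (Some z) (\<zeta> l)) = (\<Sum>a\<in>Z - {z}. 2 / (z - a))"
    if "k \<in> ?I" "\<zeta> k = Some z" for k z
  proof -
    have "(\<Sum>l\<in>?I - {k}. 2 * recip_diff (Some z) (\<zeta> l)) =
        (\<Sum>w\<in>\<zeta> ` (?I - {k}). 2 * recip_diff (Some z) w)"
      using assms(2) by (subst sum.reindex) (auto intro: inj_on_diff)
    also have "\<zeta> ` (?I - {k}) = \<zeta> ` ?I - {Some z}"
      using inj_on_image_set_diff[OF assms(2), of ?I "{k}"] that by simp
    also have "(\<Sum>w\<in>\<zeta> ` ?I - {Some z}. 2 * recip_diff (Some z) w) =
        (\<Sum>w\<in>Some ` (Z - {z}). 2 * recip_diff (Some z) w)"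
    proof (intro sum.mono_neutral_right ballI)
      fix w assume "w \<in> \<zeta> ` ?I - {Some z} - Some ` (Z - {z})"
      then have "w = None" by (cases w) (auto simp: Z)
      then show "2 * recip_diff (Some z) w = 0" by (simp add: recip_diff_def)
    qed (auto simp: Z)
    also have "\<dots> = (\<Sum>a\<in>Z - {z}. 2 / (z - a))"
      by (subst sum.reindex) (auto simp: recip_diff_def)
    finally show ?thesis .
  qed
  have "stationary_relation n x \<zeta> \<longleftrightarrow> (\<forall>k\<in>?I. \<forall>z. \<zeta> k = Some z \<longrightarrow>
      (\<Sum>a\<in>S. 1 / (z - a)) = (\<Sum>a\<in>Z - {z}. 2 / (z - a)))"
    unfolding stationary_relation_def
  proof (intro ball_cong refl)
    fix k assume k: "k \<in> ?I"
    show "(\<Sum>j = 1..2*n. recip_diff (\<zeta> k) (Some (complex_of_real (x j)))) =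
        (\<Sum>l\<in>?I - {k}. 2 * recip_diff (\<zeta> k) (\<zeta> l)) \<longleftrightarrow>
      (\<forall>z. \<zeta> k = Some z \<longrightarrow> (\<Sum>a\<in>S. 1 / (z - a)) = (\<Sum>a\<in>Z - {z}. 2 / (z - a)))"
    proof (cases "\<zeta> k")
      case None
      then show ?thesis by (simp add: recip_diff_def)
    next
      case (Some z)
      then show ?thesis using left[of z] right[OF k Some] by simp
    qed
  qed
  also have "\<dots> \<longleftrightarrow> (\<forall>z\<in>Z. (\<Sum>a\<in>S. 1 / (z - a)) = (\<Sum>a\<in>Z - {z}. 2 / (z - a)))"
    unfolding Ball_def[of Z] mem_Z by blast
  finally show ?thesis .
qed

theorem theorem2p5:
  fixes n :: nat and x :: "nat \<Rightarrow> real" and \<zeta> :: "nat \<Rightarrow> sphere"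
  assumes "n \<ge> 1"
    and "inj_on x {1..2*n}"
    and "inj_on \<zeta> {1..n+1}"
    and "\<forall>k \<in> {1..n+1}. cnj_sphere (\<zeta> k) \<in> \<zeta> ` {1..n+1}"
  shows "(\<exists>R \<in> CRR (n+1) (x ` {1..2*n}). poles R = \<zeta> ` {1..n+1}) \<longleftrightarrow>
     \<zeta> ` {1..n+1} \<inter> (\<lambda>j. Some (complex_of_real (x j))) ` {1..2*n} = {} \<and>
     stationary_relation n x \<zeta>"
proof -
  define X where "X = x ` {1..2*n}"
  define S where "S = complex_of_real ` X"
  define A where "A = \<zeta> ` {1..n+1}"
  define Z where "Z = {z. Some z \<in> A}"
  have X: "finite X" "card X = 2 * n" using assms(2) by (simp_all add: X_def card_image)
  have A: "finite A" "card A = Suc n" using assms(3) by (simp_all add: A_def card_image)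
  have fin: "finite S" "finite Z"
    using X A by (auto simp: S_def Z_def intro: finite_vimageI[of A Some, unfolded vimage_def])
  \<comment> \<open>Whether infinity is a prescribed pole is read off from the number of finite
    ones: \<open>n\<close> or \<open>n + 1\<close>.\<close>
  have "A = (if None \<in> A then insert None (Some ` Z) else Some ` Z)"
    by (auto simp: Z_def) (metis image_iff mem_Collect_eq not_None_eq)+
  then have "card A = (if None \<in> A then Suc (card Z) else card Z)"
    using fin(2) by (metis card_image card_insert_disjoint finite_imageI image_iff inj_Some
        option.distinct(1))
  then have cardZ: "card Z = (if None \<in> A then n else Suc n)" using A by (auto split: if_splits)
  have disj: "A \<inter> (\<lambda>j. Some (complex_of_real (x j))) ` {1..2*n} = {} \<longleftrightarrow> Z \<inter> S = {}"
    by (auto simp: Z_def S_def X_def)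
  have stat: "stationary_relation n x \<zeta> \<longleftrightarrow>
      (\<forall>z\<in>Z. (\<Sum>a\<in>S. 1 / (z - a)) = (\<Sum>a\<in>Z - {z}. 2 / (z - a)))"
    using assms by (intro stationary_relation_iff) (auto simp: S_def X_def Z_def A_def)
  have "(\<exists>R \<in> CRR (n+1) X. poles R = A) \<longleftrightarrow>
    Z \<inter> S = {} \<and> (\<forall>z\<in>Z. (\<Sum>a\<in>S. 1 / (z - a)) = (\<Sum>a\<in>Z - {z}. 2 / (z - a)))"
  proof
    assume "\<exists>R \<in> CRR (n+1) X. poles R = A"
    then obtain p q where pq: "q \<noteq> 0" "coprime p q" "max (degree p) (degree q) = Suc n"
      and crit: "critical_points (rational_map p q) = (\<lambda>x. Some (complex_of_real x)) ` X"
      and poles: "poles (rational_map p q) = A"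
      by (auto simp: CRR_def real_rational_maps_def)
    obtain b where b: "b \<noteq> 0" "wronskian p q = smult b (root_poly X)"
      using crit critical_points_eq_iff[OF assms(1) pq(2,1,3) X] by blast
    let ?P = "cpoly p" and ?Q = "cpoly q"
    have W: "wronskian ?P ?Q = smult (of_real b) (root_poly S)"
      by (simp add: b cpoly_smult cpoly_root_poly S_def flip: cpoly_wronskian)
    have Zroots: "z \<in> Z \<longleftrightarrow> poly ?Q z = 0" for z
      by (simp add: Z_def Some_pole_iff flip: poles)
    \<comment> \<open>A pole at infinity forces \<open>degree q < degree p\<close>, matching the
      smaller \<open>card Z\<close>. Hence \<open>q\<close> has no room for multiple roots.\<close>
    have "degree q \<le> card Z"
      using pq(3) None_pole_iff[of p q] by (auto simp: cardZ poles)
    then have Q: "?Q = smult (coeff ?Q (card Z)) (root_poly Z)"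
      using Zroots fin by (intro poly_eq_smult_root_poly) (auto simp: degree_cpoly)
    then have c: "coeff ?Q (card Z) \<noteq> 0" using pq(1) by (metis cpoly_eq_0_iff smult_0_left)
    \<comment> \<open>At a zero of \<open>q\<close> the Wronskian is - P Q', and neither factor
      vanishes, by coprimality and simplicity of the roots.\<close>
    have nonroot: "poly (wronskian ?P ?Q) z \<noteq> 0" if "z \<in> Z" for z
    proof -
      have "poly (pderiv ?Q) z \<noteq> 0"
        using that fin c pderiv_root_poly_at_root(1)[OF fin(2) that]
          poly_root_poly_eq_0_iff[of "Z - {z}" z]
        by (subst Q) (simp add: pderiv_smult)
      moreover have "poly ?P z \<noteq> 0" using that Zroots pq(2) coprime_iff_no_common_root by blast
      ultimately show ?thesis using that Zroots by (simp add: wronskian_def)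
    qed
    then have ZS: "z \<notin> S" if "z \<in> Z" for z
      using that fin W poly_root_poly_eq_0_iff[of S z] by auto
    moreover have "(\<Sum>a\<in>S. 1 / (z - a)) = (\<Sum>a\<in>Z - {z}. 2 / (z - a))" if "z \<in> Z" for z
    proof (subst stationary_iff_derivatives[OF fin that ZS[OF that] W _ Q c, symmetric])
      \<comment> \<open>The terms P' Q' cancel in the derivative of the Wronskian, so at a zero of Q
        both sides equal - P Q' Q''.\<close>
      show "poly (pderiv (wronskian ?P ?Q)) z * poly (pderiv ?Q) z =
          poly (wronskian ?P ?Q) z * poly (pderiv (pderiv ?Q)) z"
        using that Zroots by (simp add: wronskian_def pderiv_diff pderiv_mult)
    qed (use b in auto)
    ultimately show "Z \<inter> S = {} \<and>
        (\<forall>z\<in>Z. (\<Sum>a\<in>S. 1 / (z - a)) = (\<Sum>a\<in>Z - {z}. 2 / (z - a)))"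
      by blast
  next
    assume ass: "Z \<inter> S = {} \<and>
        (\<forall>z\<in>Z. (\<Sum>a\<in>S. 1 / (z - a)) = (\<Sum>a\<in>Z - {z}. 2 / (z - a)))"
    have "cnj z \<in> Z" if "z \<in> Z" for z
    proof -
      obtain k where "k \<in> {1..n+1}" "\<zeta> k = Some z"
        using \<open>z \<in> Z\<close> unfolding Z_def A_def mem_Collect_eq image_iff by metis
      then have "Some (cnj z) \<in> A" using assms(4) unfolding A_def by fastforce
      then show ?thesis by (simp add: Z_def)
    qed
    then obtain q where q: "cpoly q = root_poly Z"
      using real_poly_with_roots fin(2) by metis
    define W where "W = root_poly X"
    have cW: "cpoly W = root_poly S" by (simp add: W_def S_def cpoly_root_poly)
    have Zroots: "z \<in> Z \<longleftrightarrow> poly (cpoly q) z = 0" for z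
      using fin poly_root_poly_eq_0_iff[of Z z] by (simp add: q)
    have Sroots: "z \<in> S \<longleftrightarrow> poly (cpoly W) z = 0" for z
      using fin poly_root_poly_eq_0_iff[of S z] by (simp add: cW)
    have degq: "degree q = card Z" using q degree_cpoly degree_root_poly by metis
    have "complex_of_real (lead_coeff q) = 1"
      using coeff_root_poly_card[of Z] by (simp add: degq flip: q) (simp add: coeff_map_poly)
    then have monic: "lead_coeff q = 1" by simp
    have "poly (pderiv (cpoly q)) z \<noteq> 0" if "z \<in> Z" for z
      using that fin pderiv_root_poly_at_root(1)[OF fin(2) that]
        poly_root_poly_eq_0_iff[of "Z - {z}" z] by (simp add: q)
    then have cop: "coprime q (pderiv q)"
      unfolding coprime_iff_no_common_root by (metis Zroots cpoly_pderiv)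
    have dvd: "q dvd pderiv W * pderiv q - W * pderiv (pderiv q)"
    proof (rule dvd_if_vanishes_on_roots[OF fin(2) q])
      fix z assume z: "z \<in> Z"
      then have "z \<notin> S" using ass by blast
      show "poly (cpoly (pderiv W * pderiv q - W * pderiv (pderiv q))) z = 0"
        using stationary_iff_derivatives[OF fin z \<open>z \<notin> S\<close>, of "cpoly W" 1 "cpoly q" 1] ass z
        by (simp add: cpoly_simps q cW)
    qed
    obtain p where p: "wronskian p q = W" "max (degree p) (degree q) = Suc n"
      "degree q < degree p \<longleftrightarrow> degree q = n"
    proof (rule wronskian_solution[OF assms(1) _ monic cop _ _ dvd])
      show "degree q = n \<or> degree q = Suc n" by (simp add: degq cardZ)
      show "degree W = 2 * n" "lead_coeff W = 1"
        using X coeff_root_poly_card[of X] by (simp_all add: W_def degree_root_poly)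
    qed
    \<comment> \<open>A common zero would be a zero of the Wronskian \<open>W\<close>, hence lie in
      both \<open>Z\<close> and \<open>S\<close>.\<close>
    have "coprime p q"
      unfolding coprime_iff_no_common_root
    proof (intro allI, rule ccontr)
      fix z assume "\<not> (poly (cpoly p) z \<noteq> 0 \<or> poly (cpoly q) z \<noteq> 0)"
      then have "poly (cpoly W) z = 0" "poly (cpoly q) z = 0"
        by (auto simp: wronskian_def cpoly_simps simp flip: p(1))
      then show False using ass Zroots Sroots by blast
    qed
    moreover have "q \<noteq> 0" using monic by auto
    moreover have "critical_points (rational_map p q) = (\<lambda>x. Some (complex_of_real x)) ` X"
      using critical_points_eq_iff[OF assms(1) \<open>coprime p q\<close> \<open>q \<noteq> 0\<close> p(2) X] p(1)
      by (metis W_def smult_1_left zero_neq_one)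
    ultimately have "rational_map p q \<in> CRR (n+1) X"
      using p(2) by (auto simp: CRR_def real_rational_maps_def)
    \<comment> \<open>Finite poles are the roots of \<open>q\<close>; the pole at infinity is
      settled by the degree condition obtained with \<open>p\<close>.\<close>
    moreover have "w \<in> poles (rational_map p q) \<longleftrightarrow> w \<in> A" for w
    proof (cases w)
      case None
      have "w \<in> poles (rational_map p q) \<longleftrightarrow> degree q = n"
        unfolding None None_pole_iff by (rule p(3))
      also have "\<dots> \<longleftrightarrow> w \<in> A" by (simp add: degq cardZ None)
      finally show ?thesis .
    next
      case (Some z)
      then show ?thesis using Zroots[of z] by (simp add: Some_pole_iff Z_def)
    qed
    ultimately show "\<exists>R \<in> CRR (n+1) X. poles R = A" by blast
  qed
  then show ?thesis
    unfolding X_def[symmetric] A_def[symmetric] disj stat .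
qed

end
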